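(* Let $k,m$ be positive integers with $m\ge 3$, let $p$ be an odd prime, and suppose $n=2^kp^m$ is $2$-near perfect, with omitted divisors $d_1,d_2$ (i.e. $d_1\ne d_2$ are positive divisors of $n$ with $\sigma(n)=2n+d_1+d_2$). Then $m=3$, $p=2^{k+1}-1$, and the omitted divisors are $p$ and $p^2$, i.e. $\{d_1,d_2\}=\{p,p^2\}$.
   Context: $\sigma(n)$ denotes the sum of all positive divisors of $n$. A positive integer $n$ is called $2$-near perfect if there exist two distinct positive divisors $d_1,d_2$ of $n$ with $\sigma(n)=2n+d_1+d_2$; such $d_1,d_2$ are called omitted divisors of $n$. *)

theory Defs
  imports "HOL-Computational_Algebra.Primes"
begin

definition divisor_sum :: "nat \<Rightarrow> nat" where
  "divisor_sum n = \<Sum>{d. d dvd n}"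

(* The omitted divisors may be any divisors of n; in particular d = n is not excluded. *)
definition omitted_divisors :: "nat \<Rightarrow> nat \<Rightarrow> nat \<Rightarrow> bool" where
  "omitted_divisors n d1 d2 \<longleftrightarrow>
     n > 0 \<and> d1 dvd n \<and> d2 dvd n \<and> d1 \<noteq> d2 \<and> divisor_sum n = 2 * n + d1 + d2"

definition two_near_perfect :: "nat \<Rightarrow> bool" where
  "two_near_perfect n \<longleftrightarrow> (\<exists>d1 d2. omitted_divisors n d1 d2)"

end

theory Submission
  imports Defs
begin

text \<open>
  Write \<open>N = 2 ^ (k + 1)\<close>, \<open>T = 1 + p + \<dots> + p ^ (m - 1)\<close>, \<open>d1 = 2 ^ a * p ^ b\<close> and
  \<open>d2 = 2 ^ c * p ^ e\<close> with \<open>b \<le> e\<close>. The hypothesis on \<open>\<sigma>(n)\<close> becomes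
  \<open>(N - 1) * T = p ^ m + d1 + d2\<close>, or equivalently \<open>(N - p) * T = 1 + d1 + d2\<close>, so \<open>N > p\<close>;
  moreover \<open>p ^ b\<close> divides \<open>N - 1\<close> because \<open>T\<close> is 1 modulo \<open>p\<close>, and \<open>2 ^ a, 2 ^ c \<le> N / 2\<close>.

  If \<open>e < m\<close>, comparing sizes forces \<open>N = p + 1\<close>, and peeling off powers of \<open>p\<close> leaves only
  \<open>d1 = p\<close>, \<open>d2 = p ^ 2\<close>, \<open>m = 3\<close>. If \<open>e = m\<close>, divisibility by powers of 2 sharpens the bound on \<open>2 ^ c\<close>,
  and size comparisons exclude everything except \<open>b = m - 1\<close>. There \<open>N / 2 ^ c\<close> must be
  the power of 2 between \<open>p\<close> and \<open>2 * p\<close>; with \<open>R = N / 2 ^ a\<close> and \<open>u = (N - 1) / p ^ b\<close>, the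
  critical case gives \<open>u * (p ^ b - R) = p ^ 2 * R - 1\<close> with \<open>2 * R \<le> p + 1\<close>, which has no solution.
\<close>

section \<open>The equation between exponents, over the integers\<close>

text \<open>Taking \<open>p\<close> as an integer keeps differences such as \<open>N - p\<close>
  free of truncation. The two divisors enter symmetrically, so \<open>b \<le> e\<close> only fixes
  their order; \<open>distinct\<close> is \<open>d1 \<noteq> d2\<close> read off the
  exponents.\<close>

locale omitted_exponents =
  fixes p :: int and k m a b c e :: nat
  assumes p_ge_3: "p \<ge> 3" and odd_p: "odd p" and m_ge_3: "m \<ge> 3"
    and a_le: "a \<le> k" and c_le: "c \<le> k" and b_le: "b \<le> e" and e_le: "e \<le> m"
    and distinct: "b = e \<Longrightarrow> a \<noteq> c"
    and sigma_eq: "(2 ^ (k + 1) - 1) * (\<Sum>i<m. p ^ i) = p ^ m + 2 ^ a * p ^ b + 2 ^ c * p ^ e"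
begin

definition N :: int where "N = 2 ^ (k + 1)"

definition T :: "nat \<Rightarrow> int" where "T j = (\<Sum>i<j. p ^ i)"

lemma T_0: "T 0 = 0"
  by (simp add: T_def)

lemma T_Suc: "T (Suc j) = T j + p ^ j"
  by (simp add: T_def)

lemma T_Suc_shift: "T (Suc j) = 1 + p * T j"
  unfolding T_def by (simp add: sum.lessThan_Suc_shift sum_distrib_left del: sum.lessThan_Suc)

lemma T_geometric: "(p - 1) * T j = p ^ j - 1"
  by (induction j) (simp_all add: T_0 T_Suc algebra_simps)

lemma T_nonneg: "T j \<ge> 0"
  unfolding T_def using p_ge_3 by (intro sum_nonneg) auto

lemma T_mono: "i \<le> j \<Longrightarrow> T i \<le> T j"
  unfolding T_def using p_ge_3 by (intro sum_mono2) auto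

lemma p_power_mono: "i \<le> j \<Longrightarrow> p ^ i \<le> p ^ j"
  using p_ge_3 by (intro power_increasing) auto

lemma p_power_ge_1: "p ^ j \<ge> 1"
  using p_ge_3 by simp

lemma T_2: "T 2 = 1 + p"
  by (simp add: numeral_2_eq_2 T_0 T_Suc_shift)

lemma T_3: "T 3 = 1 + p + p\<^sup>2"
  by (simp add: numeral_3_eq_3 numeral_2_eq_2 T_0 T_Suc_shift algebra_simps)

lemma T_4: "T 4 = 1 + p + p\<^sup>2 + p ^ 3"
  using T_Suc[of 3] T_3 by simp

lemma T_m_ge: "T m \<ge> 1 + p + p\<^sup>2"
  using T_mono[OF m_ge_3] T_3 by simp

lemma m_eq_Suc3:
  obtains r where "m = Suc (Suc (Suc r))"
  using m_ge_3 that[of "m - 3"] by simp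

lemma coprime_T: "j > 0 \<Longrightarrow> coprime (p ^ i) (T j)"
proof -
  assume "j > 0"
  then obtain l where "j = Suc l"
    using gr0_implies_Suc by blast
  moreover have "gcd p (1 + p * T l) = 1"
    by (metis add.commute coprime_iff_gcd_eq_1 coprime_1_right gcd_add_mult mult.commute)
  ultimately show ?thesis
    by (simp add: T_Suc_shift coprime_iff_gcd_eq_1 coprime_power_left_iff flip: coprime_iff_gcd_eq_1)
qed

lemma pow2_le: "j \<le> k \<Longrightarrow> 2 * 2 ^ j \<le> N"
  using power_increasing[of j k "2::int"] by (simp add: N_def)

lemma pow2_dvd: "j \<le> k \<Longrightarrow> 2 * 2 ^ j dvd N"
  by (simp add: N_def le_imp_power_dvd)

lemma even_N: "even N"
  by (simp add: N_def)

lemma eq_N: "(N - 1) * T m = p ^ m + 2 ^ a * p ^ b + 2 ^ c * p ^ e"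
  using sigma_eq by (simp add: N_def T_def)

text \<open>Subtracting \<open>(p - 1) * T m = p ^ m - 1\<close> from \<open>eq_N\<close> replaces
  the large term \<open>p ^ m\<close> by 1.\<close>

lemma eq_D: "(N - p) * T m = 1 + 2 ^ a * p ^ b + 2 ^ c * p ^ e"
proof -
  have "(N - p) * T m = (N - 1) * T m - (p - 1) * T m"
    by (simp add: algebra_simps)
  then show ?thesis
    using eq_N T_geometric[of m] by simp
qed

lemma N_gt_p: "N > p"
proof -
  have "(N - p) * T m > 0"
    unfolding eq_D using p_ge_3 by (intro add_pos_pos) auto
  then show ?thesis
    using T_nonneg[of m] by (simp add: zero_less_mult_iff)
qed

lemma power_b_dvd: "p ^ b dvd N - 1"
proof -
  have "p ^ b dvd p ^ m + 2 ^ a * p ^ b + 2 ^ c * p ^ e"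
    using b_le e_le by (intro dvd_add dvd_mult) (auto intro: le_imp_power_dvd)
  then have "p ^ b dvd (N - 1) * T m"
    by (simp only: eq_N)
  then show ?thesis
    using coprime_T[of m b] m_ge_3 by (simp add: coprime_dvd_mult_left_iff)
qed

text \<open>The division is exact by \<open>power_b_dvd\<close>, so that \<open>eq_u\<close> is
  \<open>eq_N\<close> with \<open>p ^ b\<close> cancelled.\<close>

definition u :: int where "u = (N - 1) div p ^ b"

lemma u_eq: "N = u * p ^ b + 1"
  using power_b_dvd by (simp add: u_def)

lemma u_ge_1: "u \<ge> 1"
proof -
  have "u * p ^ b > 0"
    using u_eq N_gt_p p_ge_3 by linarith
  then show ?thesis
    using p_power_ge_1[of b] p_ge_3 by (simp add: zero_less_mult_iff)
qed

lemma eq_u: "u * T m = p ^ (m - b) + 2 ^ a + 2 ^ c * p ^ (e - b)"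
proof -
  have "p ^ b * (u * T m) = (N - 1) * T m"
    by (simp add: u_eq)
  also have "\<dots> = p ^ b * (p ^ (m - b) + 2 ^ a + 2 ^ c * p ^ (e - b))"
    using b_le e_le by (simp add: eq_N distrib_left mult.left_commute flip: power_add)
  finally show ?thesis
    using p_ge_3 by simp
qed

section \<open>Both exponents of \<open>p\<close> below \<open>m\<close>\<close>

text \<open>Both powers of 2 are at most \<open>N / 2\<close>, so for \<open>e \<le> m - 2\<close>
  the right side of \<open>eq_D\<close> is too small. For \<open>e = m - 1\<close> it is still too
  small if \<open>N - p \<ge> p\<close>; otherwise the terms in \<open>p ^ (m - 1)\<close> cannot
  balance.\<close>

lemma b_zero_impossible:
  assumes "e < m" "b = 0"
  shows False
proof -
  let ?D = "N - p"
  have D: "?D \<ge> 1"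
    using N_gt_p by simp
  have a2: "2 * 2 ^ a \<le> N" and c2: "2 * 2 ^ c \<le> N"
    using pow2_le a_le c_le by auto
  have eq: "?D * T m = 1 + 2 ^ a + 2 ^ c * p ^ e"
    using eq_D assms by simp
  show False
  proof (cases "e = m - 1")
    case False
    define q where "q = p ^ (m - 2)"
    have q: "q \<ge> p"
      using p_power_mono[of 1 "m - 2"] m_ge_3 by (simp add: q_def)
    have e: "p ^ e \<le> q"
      unfolding q_def using assms False by (intro p_power_mono) auto
    obtain r where r: "m = Suc (Suc (Suc r))"
      by (rule m_eq_Suc3)
    have T: "T m \<ge> q * p + q + 1"
      using T_mono[of 1 "Suc r"] by (simp add: r T_Suc q_def T_0 algebra_simps)
    have "2 * (?D * (q * p + q + 1)) \<le> 2 * (?D * T m)"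
      using T D by (intro mult_left_mono) auto
    also have "\<dots> = 2 + 2 * 2 ^ a + (2 * 2 ^ c) * p ^ e"
      by (simp add: eq)
    also have "\<dots> \<le> 2 + N + N * q"
      using a2 c2 e N_gt_p p_ge_3 by (intro add_mono mult_mono) auto
    finally have "2 * (?D * (q * p + q + 1)) \<le> 2 + (?D + p) * (1 + q)"
      by (simp add: algebra_simps)
    then have *: "?D * (2 * (q * p) + q + 1) \<le> 2 + p * (1 + q)"
      by (simp add: algebra_simps)
    have "1 * (2 * (q * p) + q + 1) \<le> ?D * (2 * (q * p) + q + 1)"
      using D q p_ge_3 by (intro mult_right_mono) auto
    also note *
    finally have "q * p + q \<le> 1 + p"
      by (simp add: algebra_simps)
    moreover have "q * p \<ge> q * 3"
      using q p_ge_3 by (intro mult_left_mono) auto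
    ultimately show False
      using q p_ge_3 by linarith
  next
    case e: True
    define Q where "Q = p ^ (m - 1)"
    have Q: "Q \<ge> p\<^sup>2"
      unfolding Q_def using m_ge_3 by (intro p_power_mono) auto
    obtain r where r: "m = Suc (Suc (Suc r))"
      by (rule m_eq_Suc3)
    have T: "T m \<ge> Q + p + 1"
      using T_mono[of 2 "Suc (Suc r)"] by (simp add: r T_Suc[of "Suc (Suc r)"] Q_def T_2)
    show False
    proof (cases "?D \<ge> p")
      case True
      \<comment> \<open>Here \<open>N \<le> 2 * ?D\<close>, so both powers of 2 are at most
        \<open>?D\<close>.\<close>
      have "?D * (Q + p + 1) \<le> ?D * T m"
        using T D by (intro mult_left_mono) auto
      also have "\<dots> = 1 + 2 ^ a + 2 ^ c * Q"
        by (simp add: eq e Q_def)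
      also have "\<dots> \<le> 1 + ?D + ?D * Q"
        using a2 c2 True Q p_ge_3 by (intro add_mono mult_right_mono) (auto intro: order_trans[of 0 "p\<^sup>2"])
      finally have "?D * p \<le> 1"
        by (simp add: algebra_simps)
      moreover have "?D * p \<ge> 1 * p"
        using D p_ge_3 by (intro mult_right_mono) auto
      ultimately show False
        using p_ge_3 by simp
    next
      case False
      have a': "2 ^ a \<le> p - 1"
        using a2 False by linarith
      \<comment> \<open>After multiplication by \<open>p - 1\<close>, \<open>y\<close> is the net
        coefficient of \<open>Q\<close>. The other terms add up to a positive number below
        \<open>p ^ 2 \<le> Q\<close>, which is no multiple of \<open>Q\<close>.\<close>
      define y where "y = ?D * p - (p - 1) * 2 ^ c"
      have "(p - 1) * (?D * T m) = ?D * (Q * p - 1)"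
        using T_geometric[of m] by (simp add: mult.left_commute[of "p - 1"]) (simp add: Q_def r)
      then have yQ: "y * Q = (p - 1) + ?D + (p - 1) * 2 ^ a"
        unfolding eq by (simp add: y_def e Q_def algebra_simps)
      also have "\<dots> \<le> (p - 1) + (p - 1) + (p - 1) * (p - 1)"
        using False a' p_ge_3 by (intro add_mono mult_left_mono) auto
      also have "\<dots> < p\<^sup>2"
        by (simp add: power2_eq_square algebra_simps)
      finally have lt: "y * Q < p\<^sup>2" .
      have "y * Q > 0"
        unfolding yQ using D p_ge_3 by (intro add_pos_pos) auto
      then have "y \<ge> 1"
        using Q p_ge_3 by (smt (verit) zero_less_mult_iff zero_le_power2)
      then have "1 * Q \<le> y * Q"
        using Q p_ge_3 by (intro mult_right_mono) (auto intro: order_trans[of 0 "p\<^sup>2"])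
      then show False
        using lt Q by simp
    qed
  qed
qed

text \<open>\<open>p\<close> divides \<open>N - 1\<close>, so the only alternative is
  \<open>N \<ge> 2 * p + 1\<close>. Sizes in \<open>eq_N\<close> exclude it for
  \<open>b \<le> m - 2\<close>; for \<open>b = e = m - 1\<close>, \<open>eq_u\<close> pushes both
  powers of 2 up to \<open>N / 2\<close>, against \<open>distinct\<close>.\<close>

lemma N_eq_Suc_p:
  assumes "e < m" "b \<ge> 1"
  shows "N = p + 1"
proof (rule ccontr)
  assume "N \<noteq> p + 1"
  have a2: "2 * 2 ^ a \<le> N" and c2: "2 * 2 ^ c \<le> N"
    using pow2_le a_le c_le by auto
  have "p dvd N - 1"
    using power_b_dvd assms(2) by (meson dvd_power dvd_trans le_imp_power_dvd order_less_le_trans zero_less_one)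
  then obtain j where j: "N - 1 = p * j" ..
  have "p * j > p * 1"
    using N_gt_p \<open>N \<noteq> p + 1\<close> j by simp
  then have "j \<ge> 2"
    using p_ge_3 by (simp only: mult_less_cancel_left_pos)
  then have "p * 2 \<le> p * j"
    using p_ge_3 by (intro mult_left_mono) auto
  then have N: "N \<ge> 2 * p + 1"
    using j by simp
  show False
  proof (cases "b \<le> m - 2")
    case True
    obtain r where r: "m = Suc (Suc (Suc r))"
      by (rule m_eq_Suc3)
    \<comment> \<open>Factoring out \<open>p ^ r\<close> leaves the inequality for
      \<open>m = 3\<close>.\<close>
    define q where "q = p ^ r"
    have q: "q \<ge> 1"
      unfolding q_def by (rule p_power_ge_1)
    have T: "T m \<ge> q * (p\<^sup>2 + p + 1)"
      using T_nonneg[of r] by (simp add: r T_Suc q_def algebra_simps power2_eq_square)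
    have pb: "p ^ b \<le> q * p" "p ^ e \<le> q * p\<^sup>2"
      using p_power_mono[of b "Suc r"] p_power_mono[of e "Suc (Suc r)"] True assms(1)
      by (simp_all add: r q_def power2_eq_square algebra_simps)
    have "2 * ((N - 1) * (q * (p\<^sup>2 + p + 1))) \<le> 2 * ((N - 1) * T m)"
      using T N_gt_p p_ge_3 by (intro mult_left_mono) auto
    also have "\<dots> = 2 * p ^ m + (2 * 2 ^ a) * p ^ b + (2 * 2 ^ c) * p ^ e"
      by (simp add: eq_N)
    also have "\<dots> \<le> 2 * p ^ m + N * (q * p) + N * (q * p\<^sup>2)"
      using a2 c2 pb N_gt_p p_ge_3 by (intro add_mono mult_mono) auto
    also have "\<dots> = q * (2 * p ^ 3 + N * (p + p\<^sup>2))"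
      by (simp add: q_def r algebra_simps eval_nat_numeral)
    finally have "q * (2 * ((N - 1) * (p\<^sup>2 + p + 1))) \<le> q * (2 * p ^ 3 + N * (p + p\<^sup>2))"
      by (simp add: algebra_simps)
    then have "2 * ((N - 1) * (p\<^sup>2 + p + 1)) \<le> 2 * p ^ 3 + N * (p + p\<^sup>2)"
      using q by simp
    then have "N * (p\<^sup>2 + p + 2) \<le> 2 * p ^ 3 + 2 * (p\<^sup>2 + p + 1)"
      by (simp add: algebra_simps)
    moreover have "(2 * p + 1) * (p\<^sup>2 + p + 2) \<le> N * (p\<^sup>2 + p + 2)"
      using N p_ge_3 by (intro mult_right_mono) auto
    moreover have "(2 * p + 1) * (p\<^sup>2 + p + 2) = 2 * p ^ 3 + 3 * p\<^sup>2 + 5 * p + 2"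
      by (simp add: algebra_simps eval_nat_numeral)
    ultimately have "p\<^sup>2 + 3 * p \<le> 0"
      by simp
    then show False
      using p_ge_3 zero_le_power2[of p] by linarith
  next
    case False
    then have b: "b = m - 1" and e: "e = b"
      using assms b_le by auto
    obtain r where r: "m = Suc r" "r \<ge> 2"
        using m_ge_3 that[of "m - 1"] by simp
    have "u * T r \<ge> 1 * (1 + p)"
      using u_ge_1 T_mono[OF r(2)] T_2 p_ge_3 by (intro mult_mono) auto
    then have "u * T m \<ge> N + p"
      using u_eq b r by (simp add: T_Suc distrib_left)
    then have "2 ^ a + 2 ^ c \<ge> N"
      using eq_u b e r by simp
    then have "(2::int) ^ a = 2 ^ c"
      using a2 c2 by linarith
    then show False
      using distinct e by simp
  qed
qed

text \<open>With \<open>N = p + 1\<close>, \<open>eq_D\<close> says that \<open>T m\<close> is 1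
  plus the two divisors. Cancelling the 1 and a factor \<open>p\<close> leaves a similar equation
  for \<open>T (m - 1)\<close>; reduction modulo \<open>p\<close> and the bound
  \<open>(p + 1) / 2\<close> on the powers of 2 then settle the exponents one by one.\<close>

lemma below_top:
  assumes "e < m"
  shows "m = 3 \<and> N = p + 1 \<and> a = 0 \<and> b = 1 \<and> c = 0 \<and> e = 2"
proof -
  have b: "b \<ge> 1"
    using b_zero_impossible assms by (cases b) auto
  have N: "N = p + 1"
    using N_eq_Suc_p assms b by simp
  have a2: "2 * 2 ^ a \<le> p + 1" and c2: "2 * 2 ^ c \<le> p + 1"
    using pow2_le a_le c_le N by auto
  obtain r where r: "m = Suc (Suc (Suc r))"
    by (rule m_eq_Suc3)
  obtain b' e' where be: "b = Suc b'" "e = Suc e'"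
    using b b_le that[of "b - 1" "e - 1"] by simp
  have "p * T (Suc (Suc r)) = p * (2 ^ a * p ^ b' + 2 ^ c * p ^ e')"
    using eq_D by (simp add: N r be T_Suc_shift[of "Suc (Suc r)"] algebra_simps)
  then have T': "T (Suc (Suc r)) = 2 ^ a * p ^ b' + 2 ^ c * p ^ e'"
    using p_ge_3 by simp
  have not_dvd: "\<not> p dvd T (Suc l)" for l
    using coprime_T[of "Suc l" 1] p_ge_3 by (auto dest: coprime_common_divisor[of _ _ p])
  have b': "b' = 0"
  proof (rule ccontr)
    assume "b' \<noteq> 0"
    then have "p dvd 2 ^ a * p ^ b' + 2 ^ c * p ^ e'"
      using b_le be by (intro dvd_add dvd_mult) auto
    then show False
      using not_dvd T' by metis
  qed
  have T_ge: "T (Suc (Suc l)) \<ge> 1 + p" for l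
    using T_mono[of 2 "Suc (Suc l)"] T_2 by simp
  have "e' \<noteq> 0"
  proof
    assume "e' = 0"
    then have "2 ^ a + 2 ^ c \<ge> 1 + p"
      using T_ge[of r] T' b' by simp
    then have "(2::int) ^ a = 2 ^ c"
      using a2 c2 by linarith
    then show False
      using distinct be b' \<open>e' = 0\<close> by simp
  qed
  then obtain f where f: "e' = Suc f"
    using not0_implies_Suc by blast
  \<comment> \<open>Second peeling: modulo \<open>p\<close> only \<open>2 ^ a - 1\<close> survives,
    and it is too small to be a nonzero multiple of \<open>p\<close>.\<close>
  have eq: "2 ^ a - 1 = p * (T (Suc r) - 2 ^ c * p ^ f)"
    using T' by (simp add: b' f T_Suc_shift[of "Suc r"] algebra_simps)
  then have "p dvd 2 ^ a - 1"
    by simp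
  moreover have "2 ^ a - 1 < p"
    using a2 p_ge_3 by linarith
  moreover have "(2::int) ^ a \<ge> 1"
    by simp
  ultimately have "2 ^ a - 1 = (0::int)"
    using zdvd_not_zless[of "2 ^ a - 1" p] by linarith
  then have a: "a = 0" and T'': "T (Suc r) = 2 ^ c * p ^ f"
    using eq p_ge_3 by auto
  have f0: "f = 0"
    using not_dvd[of r] T'' by (cases f) auto
  have r0: "r = 0"
  proof (rule ccontr)
    assume "r \<noteq> 0"
    then obtain s where "r = Suc s"
      using not0_implies_Suc by blast
    then show False
      using T_ge[of s] T'' f0 c2 p_ge_3 by simp
  qed
  then have "(2::int) ^ c = 1"
    using T'' f0 by (simp add: T_Suc T_0)
  then show ?thesis
    using a N r r0 be b' f f0 by simp
qed

section \<open>Exponent \<open>m\<close> in both divisors\<close>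

text \<open>Multiplying \<open>eq_u\<close> by \<open>p - 1\<close> expresses \<open>N\<close>
  through \<open>u + p\<close> and the powers of 2, which divisibility bounds in turn. The resulting
  \<open>2 * N \<le> (u + p) * (p * (p + 1))\<close> is too small for
  \<open>N = u * p ^ m + 1\<close> with \<open>m \<ge> 3\<close>.\<close>

lemma top_top_impossible:
  assumes "e = m" "b = m"
  shows False
proof -
  have eq1: "u * T m = 1 + 2 ^ a + 2 ^ c"
    using eq_u assms by simp
  have eq2: "N = u * p ^ m + 1"
    using u_eq assms by simp
  have "u * (p ^ m - 1) = (p - 1) * (u * T m)"
    by (simp add: T_geometric mult.left_commute)
  then have N: "N = u + p + (p - 1) * 2 ^ a + (p - 1) * 2 ^ c"
    unfolding eq1 eq2 by (simp add: algebra_simps)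
  \<comment> \<open>The smaller of the two powers of 2 divides \<open>u + p\<close>, which then bounds the larger one.\<close>
  have bound: "N * 2 \<le> (u + p) * (p * (p + 1))"
    if ij: "i < j" "j \<le> k" and Nij: "N = u + p + (p - 1) * 2 ^ i + (p - 1) * 2 ^ j" for i j
  proof -
    have "2 * 2 ^ i dvd (p - 1) * 2 ^ i"
      using odd_p by (intro mult_dvd_mono) auto
    moreover have "2 * 2 ^ i dvd (p - 1) * 2 ^ j"
    proof -
      have "(2::int) ^ Suc i dvd 2 ^ j"
        using ij by (intro le_imp_power_dvd) simp
      then show ?thesis by simp
    qed
    moreover have "2 * 2 ^ i dvd N"
      using pow2_dvd ij by simp
    ultimately have "2 * 2 ^ i dvd u + p"
      using Nij by (metis (no_types, lifting) dvd_add_left_iff)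
    then have i: "2 * 2 ^ i \<le> u + p"
      using u_ge_1 p_ge_3 by (intro zdvd_imp_le) auto
    have "2 ^ j dvd N"
      using pow2_dvd[of j] ij by (meson dvd_mult_right)
    then have "2 ^ j dvd u + p + (p - 1) * 2 ^ i"
      using Nij by (metis dvd_add_left_iff dvd_triv_right)
    then have j: "2 ^ j \<le> u + p + (p - 1) * 2 ^ i"
      using u_ge_1 p_ge_3 by (intro zdvd_imp_le add_pos_pos) auto
    have "N \<le> u + p + (p - 1) * 2 ^ i + (p - 1) * (u + p + (p - 1) * 2 ^ i)"
      unfolding Nij using j p_ge_3 by (intro add_mono mult_left_mono) auto
    also have "\<dots> = p * (u + p) + (p * (p - 1)) * 2 ^ i"
      by (simp add: algebra_simps)
    finally have "N * 2 \<le> 2 * (p * (u + p)) + (p * (p - 1)) * (2 * 2 ^ i)"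
      by simp
    also have "\<dots> \<le> 2 * (p * (u + p)) + (p * (p - 1)) * (u + p)"
      using i p_ge_3 by (intro add_mono mult_left_mono) auto
    also have "\<dots> = (u + p) * (p * (p + 1))"
      by (simp add: algebra_simps)
    finally show ?thesis .
  qed
  have "N * 2 \<le> (u + p) * (p * (p + 1))"
    using bound[of a c] bound[of c a] N distinct assms a_le c_le by (cases a c rule: linorder_cases) auto
  moreover have "u * p ^ m \<ge> u * p ^ 3"
    using u_ge_1 p_power_mono[OF m_ge_3] by (intro mult_left_mono) auto
  ultimately have "2 * (u * p ^ 3) + 2 \<le> (u + p) * (p * (p + 1))"
    using eq2 by linarith
  also have "\<dots> = u * (p * (p + 1)) + p * (p * (p + 1))"
    by (simp add: algebra_simps)
  finally have *: "u * (2 * p ^ 3 - p * (p + 1)) \<le> p * (p * (p + 1)) - 2"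
    by (simp add: algebra_simps)
  have p3: "3 * p\<^sup>2 \<le> p ^ 3" "3 * p \<le> p\<^sup>2"
    using p_ge_3 mult_right_mono[of 3 p "p\<^sup>2"] mult_right_mono[of 3 p p]
    by (simp_all add: power2_eq_square power3_eq_cube mult.assoc)
  have "p * (p + 1) = p\<^sup>2 + p"
    by (simp add: power2_eq_square algebra_simps)
  then have "2 * p ^ 3 - p * (p + 1) \<ge> 0"
    using p3 p_ge_3 by linarith
  then have "1 * (2 * p ^ 3 - p * (p + 1)) \<le> u * (2 * p ^ 3 - p * (p + 1))"
    using u_ge_1 by (intro mult_right_mono)
  also note *
  also have "p * (p * (p + 1)) - 2 = p ^ 3 + p\<^sup>2 - 2"
    by (simp add: algebra_simps power2_eq_square power3_eq_cube)
  finally have "p ^ 3 + 2 \<le> 2 * p\<^sup>2 + p"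
    by (simp add: algebra_simps power2_eq_square)
  then show False
    using p3 p_ge_3 by linarith
qed

section \<open>Exponent \<open>m\<close> in exactly one divisor\<close>

text \<open>Since \<open>(p - 1) * T m = p ^ m - 1\<close>, moving \<open>2 ^ c * p ^ m\<close> to
  the left side of \<open>eq_D\<close> turns the factor \<open>N - p\<close> into
  \<open>x\<close>.\<close>

definition x :: int where "x = N - p - (p - 1) * 2 ^ c"

context
  assumes e_eq: "e = m" and b_less: "b < m"
begin

lemma x_T: "x * T m = 1 + 2 ^ c + 2 ^ a * p ^ b"
proof -
  have "x * T m = (N - p) * T m - ((p - 1) * T m) * 2 ^ c"
    by (simp add: x_def algebra_simps)
  also have "\<dots> = (1 + 2 ^ a * p ^ b + 2 ^ c * p ^ e) - (p ^ m - 1) * 2 ^ c"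
    by (simp only: eq_D T_geometric)
  finally show ?thesis
    by (simp add: e_eq algebra_simps)
qed

lemma x_ge_1: "x \<ge> 1"
proof -
  have "x * T m > 0"
    unfolding x_T using p_ge_3 by (intro add_pos_pos) auto
  then show ?thesis
    using T_nonneg[of m] by (simp add: zero_less_mult_iff)
qed

lemma odd_x: "odd x"
  using odd_p even_N by (simp add: x_def)

lemma N_x: "N = p + x + (p - 1) * 2 ^ c"
  by (simp add: x_def)

text \<open>As \<open>p - 1\<close> is even, \<open>2 * 2 ^ c\<close> divides both \<open>N\<close>
  and \<open>(p - 1) * 2 ^ c\<close>, hence also the positive number \<open>p + x\<close>.\<close>

lemma pow2_c_le: "2 * 2 ^ c \<le> p + x"
proof -
  have "2 * 2 ^ c dvd (p - 1) * 2 ^ c"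
    using odd_p by (intro mult_dvd_mono) auto
  then have "2 * 2 ^ c dvd p + x"
    using pow2_dvd[OF c_le] N_x by (metis dvd_add_left_iff)
  then show ?thesis
    using x_ge_1 p_ge_3 by (intro zdvd_imp_le) auto
qed

lemma N_le_x: "2 * N \<le> (p + 1) * (p + x)"
proof -
  have "2 * N = 2 * (p + x) + (p - 1) * (2 * 2 ^ c)"
    by (simp add: N_x)
  also have "\<dots> \<le> 2 * (p + x) + (p - 1) * (p + x)"
    using pow2_c_le p_ge_3 by (intro add_mono mult_left_mono) auto
  finally show ?thesis
    by (simp add: algebra_simps)
qed

text \<open>\<open>pow2_c_le\<close> bounds \<open>2 ^ c\<close>, and \<open>N_le_x\<close> bounds
  \<open>2 ^ a \<le> N / 2\<close>; no power of 2 is left on the right side of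
  \<open>x_T\<close>.\<close>

lemma x_T_le: "4 * (x * T m) \<le> 4 + 2 * (p + x) + p ^ b * ((p + 1) * (p + x))"
proof -
  have "4 * 2 ^ a \<le> (p + 1) * (p + x)"
    using pow2_le[OF a_le] N_le_x by linarith
  then have "p ^ b * (4 * 2 ^ a) \<le> p ^ b * ((p + 1) * (p + x))"
    using p_ge_3 by (intro mult_left_mono) auto
  then show ?thesis
    unfolding x_T using pow2_c_le by (simp add: algebra_simps)
qed

lemma b_nonzero: "b \<noteq> 0"
proof
  assume "b = 0"
  have "4 * (x * (1 + p + p\<^sup>2)) \<le> 4 * (x * T m)"
    using T_m_ge x_ge_1 by (intro mult_left_mono) auto
  also have "\<dots> \<le> 4 + 2 * (p + x) + (p + 1) * (p + x)"
    using x_T_le by (simp add: \<open>b = 0\<close>)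
  finally have *: "x * (4 * p\<^sup>2 + 3 * p + 1) \<le> 4 + 3 * p + p\<^sup>2"
    by (simp add: algebra_simps power2_eq_square)
  have "1 * (4 * p\<^sup>2 + 3 * p + 1) \<le> x * (4 * p\<^sup>2 + 3 * p + 1)"
    using x_ge_1 p_ge_3 by (intro mult_right_mono) auto
  also note *
  finally have "4 * p\<^sup>2 + 3 * p + 1 \<le> 4 + 3 * p + p\<^sup>2"
    by simp
  moreover have "3 * p \<le> p\<^sup>2"
    using p_ge_3 by (simp add: power2_eq_square)
  ultimately show False
    using p_ge_3 by linarith
qed

text \<open>If \<open>b \<le> m - 2\<close>, then \<open>x_T_le\<close> forces
  \<open>3 * x \<le> p\<close>, so \<open>N\<close> is at most \<open>2 * p * (p + 1) / 3\<close>.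
  This is below \<open>p ^ b\<close> for \<open>b \<ge> 2\<close>. For \<open>b = 1\<close>, size
  excludes \<open>m \<ge> 4\<close>, and arithmetic modulo \<open>p\<close> excludes
  \<open>m = 3\<close>.\<close>

lemma b_eq_m_minus_1: "b = m - 1"
proof (rule ccontr)
  assume "b \<noteq> m - 1"
  then have b_le': "Suc (Suc b) \<le> m"
    using b_less by simp
  obtain l where l: "b = Suc l"
    using b_nonzero not0_implies_Suc by blast
  have pb: "p ^ b \<ge> 3"
    using p_power_mono[of 1 b] b_nonzero p_ge_3 by simp
  have "T m \<ge> T (Suc (Suc b))"
    by (rule T_mono[OF b_le'])
  then have "T m \<ge> p ^ b * (p + 1) + 1"
    using T_mono[of 1 b] by (simp add: T_Suc T_0 l algebra_simps)
  then have "4 * (x * (p ^ b * (p + 1) + 1)) \<le> 4 * (x * T m)"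
    using x_ge_1 by (intro mult_left_mono) auto
  also note x_T_le
  finally have *: "(p ^ b * (p + 1)) * (3 * x - p) \<le> 4 + 2 * p - 2 * x"
    by (simp add: algebra_simps)
  have x_le: "3 * x \<le> p"
  proof (rule ccontr)
    assume "\<not> 3 * x \<le> p"
    have "3 * (p + 1) \<le> (p ^ b * (p + 1)) * 1"
      unfolding mult_1_right using pb p_ge_3 by (intro mult_right_mono) auto
    also have "\<dots> \<le> (p ^ b * (p + 1)) * (3 * x - p)"
      using \<open>\<not> 3 * x \<le> p\<close> p_ge_3 by (intro mult_left_mono) auto
    also note *
    finally show False
      using x_ge_1 p_ge_3 by simp
  qed
  have "(p + 1) * (3 * (p + x)) \<le> (p + 1) * (4 * p)"
    using x_le p_ge_3 by (intro mult_left_mono) auto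
  then have N_le: "6 * N \<le> 4 * (p * (p + 1))"
    using N_le_x by (simp add: algebra_simps)
  show False
  proof (cases "b = 1")
    case False
    then have "p\<^sup>2 \<le> p ^ b"
      using b_nonzero by (intro p_power_mono) simp
    also have "\<dots> \<le> N - 1"
      using u_eq u_ge_1 mult_right_mono[of 1 u "p ^ b"] p_ge_3 by simp
    finally have "6 * p\<^sup>2 < 4 * (p * (p + 1))"
      using N_le by linarith
    then have "p * p < p * 2"
      by (simp add: power2_eq_square algebra_simps)
    then show False
      using p_ge_3 by simp
  next
    case b1: True
    show False
    proof (cases "m = 3")
      case False
      then have "T m \<ge> 1 + p + p\<^sup>2 + p ^ 3"
        using T_mono[of 4 m] T_4 m_ge_3 by simp
      then have "1 * (1 + p + p\<^sup>2 + p ^ 3) \<le> x * T m"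
        using x_ge_1 p_ge_3 by (intro mult_mono) auto
      then have "1 + p + p\<^sup>2 + p ^ 3 \<le> x * T m"
        by simp
      moreover define W where "W = p * ((p + 1) * (p + x))"
      have "p * ((p + 1) * (3 * (p + x))) \<le> p * ((p + 1) * (4 * p))"
        using x_le p_ge_3 by (intro mult_left_mono) auto
      then have "3 * W \<le> 4 * p ^ 3 + 4 * p\<^sup>2"
        by (simp add: W_def algebra_simps power2_eq_square power3_eq_cube)
      moreover have "4 * (x * T m) \<le> 4 + 2 * p + 2 * x + W"
        using x_T_le by (simp add: b1 W_def)
      moreover have "p ^ 3 \<ge> 0"
        using p_ge_3 by simp
      ultimately show False
        using x_le zero_le_power2[of p] p_ge_3 by linarith
    next
      case True
      have eq: "x * (1 + p + p\<^sup>2) = 1 + 2 ^ c + 2 ^ a * p"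
        using x_T by (simp add: True T_3 b1)
      \<comment> \<open>Modulo \<open>p\<close> only \<open>1 + 2 ^ c - x\<close> survives; being
        smaller than \<open>p\<close> in absolute value, it vanishes. Then the odd number
        \<open>x > 1\<close> divides \<open>2 ^ a\<close>.\<close>
      have "1 + 2 ^ c - x = p * (x * (1 + p) - 2 ^ a)"
        using eq by (simp add: algebra_simps power2_eq_square)
      then have "p dvd 1 + 2 ^ c - x"
        by simp
      moreover have "\<bar>1 + 2 ^ c - x\<bar> < p"
        unfolding abs_less_iff using pow2_c_le x_le x_ge_1 p_ge_3 one_le_power[of "2::int" c]
        by (intro conjI) linarith+
      ultimately have x_eq: "x = 1 + 2 ^ c"
        using zdvd_imp_le[of p "\<bar>1 + 2 ^ c - x\<bar>"] by fastforce
      then have "even ((2::int) ^ c)"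
        using odd_x by simp
      then have "coprime (1 + 2 ^ c) ((2::int) ^ a)"
        using x_eq odd_x coprime_power_right_iff[of x 2 a] by simp
      moreover have "p * ((1 + 2 ^ c) * (1 + p)) = p * 2 ^ a"
        using eq by (simp add: x_eq algebra_simps power2_eq_square)
      then have "(1 + 2 ^ c) * (1 + p) = 2 ^ a"
        using p_ge_3 by simp
      then have "1 + 2 ^ c dvd (2::int) ^ a"
        by (metis dvd_triv_left)
      ultimately have "is_unit (1 + 2 ^ c :: int)"
        by (rule coprime_common_divisor[OF _ dvd_refl])
      then show False
        by (simp add: zdvd1_eq)
    qed
  qed
qed

text \<open>For \<open>b = m - 1\<close>, \<open>eq_u\<close> becomes \<open>eq\<close> below.
  Dividing by \<open>2 ^ c\<close> isolates an excess \<open>E\<close> that sizes restrict to 0, 1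
  and 2; each value is refuted separately.\<close>

lemma top_below_impossible: False
proof -
  have b: "b \<ge> 2" and mb: "m = Suc b"
    using b_eq_m_minus_1 m_ge_3 by auto
  have N_u: "N = u * p ^ b + 1"
    by (rule u_eq)
  have eq: "2 ^ a + p * 2 ^ c + p + 1 = N + u * T b"
    using eq_u by (simp add: e_eq mb T_Suc N_u algebra_simps)
  have T_b: "T b \<ge> p + 1"
    using T_mono[OF b] T_2 by simp
  have uT: "u * T b \<ge> p + 1"
    using mult_mono[of 1 u "p + 1" "T b"] u_ge_1 T_b p_ge_3 by simp
  have uT_le: "(p - 1) * (u * T b) = N - 1 - u"
    by (simp add: mult.left_commute[of "p - 1"] T_geometric) (simp add: N_u algebra_simps)
  \<comment> \<open>\<open>S\<close> is \<open>N / 2 ^ c\<close>, even also for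
    \<open>c = k\<close>; parity therefore lifts \<open>S > p - 1\<close> to
    \<open>S > p\<close>.\<close>
  define S :: int where "S = 2 * 2 ^ (k - c)"
  have N_S: "N = S * 2 ^ c"
    using c_le by (simp add: S_def N_def flip: power_add)
  have "(p - 1) * 2 ^ c < S * 2 ^ c"
    using N_x x_ge_1 p_ge_3 N_S by linarith
  then have "p - 1 < S"
    by simp
  moreover have "even S"
    by (simp add: S_def)
  ultimately have S: "S > p"
    using odd_p by (cases "S = p") auto
  \<comment> \<open>If \<open>a < c\<close>, then \<open>2 ^ a + p * 2 ^ c < S * 2 ^ c = N\<close>, against \<open>eq\<close>.\<close>
  have "c \<le> a"
  proof (rule ccontr)
    assume "\<not> c \<le> a"
    then have "(2::int) ^ a < 2 ^ c"
      by simp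
    moreover have "(p + 1) * 2 ^ c \<le> S * 2 ^ c"
      using S by (intro mult_right_mono) auto
    then have "p * 2 ^ c + 2 ^ c \<le> N"
      by (simp add: N_S algebra_simps)
    ultimately show False
      using eq uT by linarith
  qed
  define A :: int where "A = 2 ^ (a - c)"
  define R :: int where "R = 2 * 2 ^ (k - a)"
  have pow_a: "2 ^ a = A * 2 ^ c"
    using \<open>c \<le> a\<close> by (simp add: A_def flip: power_add)
  have S_R: "S = R * A"
    using \<open>c \<le> a\<close> a_le by (simp add: S_def R_def A_def flip: power_add)
  have A: "A \<ge> 1" and R: "R \<ge> 2"
    by (auto simp: A_def R_def)
  \<comment> \<open>\<open>E \<ge> 0\<close> holds by \<open>uT\<close>, and \<open>E < 3\<close>
    because \<open>(p - 1) * (u * T b) < N = S * 2 ^ c\<close> with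
    \<open>S \<le> 2 * p\<close>.\<close>
  define E where "E = A + p - S"
  have E: "E * 2 ^ c = u * T b - p - 1"
    using eq by (simp add: E_def algebra_simps N_S pow_a)
  have "E \<ge> 0"
  proof -
    have "E * 2 ^ c \<ge> 0"
      using E uT by simp
    then show ?thesis
      by (simp add: zero_le_mult_iff)
  qed
  have "2 * A \<le> R * A"
    using A R by (intro mult_right_mono) auto
  then have A_S: "2 * A \<le> S"
    by (simp add: S_R)
  then have S_lt: "S \<le> 2 * p"
    using \<open>E \<ge> 0\<close> by (simp add: E_def)
  have "E < 3"
  proof (rule ccontr)
    assume "\<not> E < 3"
    then have "3 * 2 ^ c \<le> E * 2 ^ c"
      by (intro mult_right_mono) auto
    then have "(p - 1) * (3 * 2 ^ c) \<le> (p - 1) * (u * T b)"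
      using E p_ge_3 by (intro mult_left_mono) auto
    also have "\<dots> < S * 2 ^ c"
      using uT_le u_ge_1 N_S by simp
    finally have "(3 * (p - 1)) * 2 ^ c < S * 2 ^ c"
      by (simp add: algebra_simps)
    then have "3 * (p - 1) < S"
      by (simp only: mult_less_cancel_right_pos zero_less_power zero_less_numeral)
    then show False
      using S_lt p_ge_3 by simp
  qed
  then consider "E = 0" | "E = 1" | "E = 2"
    using \<open>E \<ge> 0\<close> by linarith
  then show False
  proof cases
    case 1
    then have "u * T b = p + 1"
      using E by simp
    then have "(p - 1) * (p + 1) = N - 1 - u"
      using uT_le by simp
    then have "N = p\<^sup>2 + u"
      by (simp add: algebra_simps power2_eq_square)
    moreover have "u * p ^ b \<ge> u * p\<^sup>2"
      using u_ge_1 p_power_mono[OF b] by (intro mult_left_mono) auto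
    ultimately have "(u - 1) * (p\<^sup>2 - 1) \<le> 0"
      using N_u by (simp add: algebra_simps)
    moreover have "p\<^sup>2 > 1"
      using p_ge_3 by (simp add: one_less_power)
    ultimately have "u = 1"
      using u_ge_1 by (simp add: mult_le_0_iff)
    then have N_p: "N = p\<^sup>2 + 1"
      using \<open>N = p\<^sup>2 + u\<close> by simp
    \<comment> \<open>The contradiction is modulo 4: an odd square plus 1 is 2, whereas 4 divides
      \<open>N\<close> once \<open>k > 0\<close>.\<close>
    have "k \<noteq> 0"
    proof
      assume "k = 0"
      then show False
        using N_gt_p[unfolded N_def] p_ge_3 by simp
    qed
    then have "4 dvd N"
      using le_imp_power_dvd[of 2 "k + 1" "2::int"] by (simp add: N_def)
    moreover obtain h where "p = 2 * h + 1"
      using odd_p by (elim oddE)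
    then have "N = 4 * (h * h + h) + 2"
      using N_p by (simp add: power2_eq_square algebra_simps)
    ultimately show False
      by presburger
  next
    case 2
    have p_eq: "p = 1 + A * (R - 1)"
      using 2 by (simp add: E_def S_R algebra_simps)
    have "A \<noteq> 1"
      using 2 \<open>even S\<close> odd_p by (auto simp: E_def)
    then have "2 * (R - 1) \<le> A * (R - 1)"
      using A R by (intro mult_right_mono) auto
    then have R_le: "2 * R \<le> p + 1"
      using p_eq by simp
    have "(p - 1) * (p + 1 + 2 ^ c) = N - 1 - u"
      using uT_le E 2 by (simp add: algebra_simps)
    then have "p\<^sup>2 + (p - 1) * 2 ^ c = S * 2 ^ c - u"
      by (simp add: N_S power2_eq_square algebra_simps)
    moreover have "A = S + 1 - p"
      using 2 by (simp add: E_def)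
    then have "2 ^ a = (S + 1 - p) * 2 ^ c"
      by (simp only: pow_a)
    ultimately have u_eq': "2 ^ a = u + p\<^sup>2"
      by (simp add: algebra_simps)
    have "N = R * 2 ^ a"
      by (simp add: N_S S_R pow_a)
    \<comment> \<open>Equates \<open>N = R * (u + p ^ 2)\<close> with
      \<open>N = u * p ^ b + 1\<close>.\<close>
    then have main: "u * (p ^ b - R) = p\<^sup>2 * R - 1"
      using N_u u_eq' by (simp add: algebra_simps)
    have sq: "3 * p \<le> p\<^sup>2"
      using p_ge_3 by (simp add: power2_eq_square)
    show False
    proof (cases "b = 2")
      case True
      \<comment> \<open>Subtracting \<open>R * (p ^ 2 - R)\<close> from \<open>main\<close> gives a
        factored form. Its right side is positive, yet below \<open>p ^ 2 - R\<close> because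
        \<open>2 * R \<le> p + 1\<close>.\<close>
      then have eq': "(u - R) * (p\<^sup>2 - R) = R\<^sup>2 - 1"
        using main by (simp add: algebra_simps power2_eq_square)
      have "R\<^sup>2 > 1"
        using R by (simp add: one_less_power)
      then have "(u - R) * (p\<^sup>2 - R) > 0"
        using eq' by simp
      moreover have "p\<^sup>2 - R > 0"
        using sq R_le p_ge_3 by linarith
      ultimately have "u - R \<ge> 1"
        by (simp add: zero_less_mult_iff)
      then have "1 * (p\<^sup>2 - R) \<le> (u - R) * (p\<^sup>2 - R)"
        using \<open>p\<^sup>2 - R > 0\<close> by (intro mult_right_mono) auto
      then have "p\<^sup>2 \<le> R\<^sup>2 + R - 1"
        using eq' by simp
      moreover have "(2 * R)\<^sup>2 \<le> (p + 1)\<^sup>2"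
        using R_le R by (intro power_mono) auto
      then have "4 * R\<^sup>2 \<le> p\<^sup>2 + 2 * p + 1"
        by (simp add: power2_eq_square algebra_simps)
      ultimately show False
        using R_le sq p_ge_3 by linarith
    next
      case False
      \<comment> \<open>For \<open>b \<ge> 3\<close> the left side of \<open>main\<close> is at
        least \<open>p ^ 3 - R\<close>, while the right side is only about half of
        \<open>p ^ 3\<close>.\<close>
      then have "p ^ 3 \<le> p ^ b"
        using b by (intro p_power_mono) simp
      moreover have "p\<^sup>2 \<le> p ^ 3"
        by (rule p_power_mono) simp
      then have "p ^ 3 - R \<ge> 0"
        using sq R_le p_ge_3 by linarith
      ultimately have "1 * (p ^ 3 - R) \<le> u * (p ^ b - R)"
        using u_ge_1 by (intro mult_mono) auto
      then have "2 * p ^ 3 + 2 \<le> p\<^sup>2 * (2 * R) + 2 * R"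
        using main by simp
      also have "\<dots> \<le> p\<^sup>2 * (p + 1) + (p + 1)"
        using R_le by (intro add_mono mult_left_mono) auto
      also have "\<dots> = p ^ 3 + p\<^sup>2 + p + 1"
        by (simp add: algebra_simps power2_eq_square power3_eq_cube)
      finally have "p ^ 3 + 1 \<le> p\<^sup>2 + p"
        by simp
      moreover have "3 * p\<^sup>2 \<le> p ^ 3"
        using mult_right_mono[of 3 p "p\<^sup>2"] p_ge_3 by (simp add: power2_eq_square power3_eq_cube)
      ultimately show False
        using sq p_ge_3 by linarith
    qed
  next
    case 3
    then have "A + p = S + 2"
      by (simp add: E_def)
    \<comment> \<open>An odd power of 2 is 1, which would give \<open>S = p - 1\<close>.\<close>
    then have "odd A"
      using \<open>even S\<close> odd_p by presburger
    then have "A = 1"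
      by (simp add: A_def split: if_splits)
    then show False
      using \<open>A + p = S + 2\<close> S by simp
  qed
qed

end

lemma exponents_unique: "m = 3 \<and> N = p + 1 \<and> a = 0 \<and> b = 1 \<and> c = 0 \<and> e = 2"
proof -
  consider "e < m" | "e = m" "b = m" | "e = m" "b < m"
    using b_le e_le by linarith
  then show ?thesis
    using below_top top_top_impossible top_below_impossible by cases blast+
qed

end

section \<open>Divisors of \<open>2 ^ k * p ^ m\<close> and their sum\<close>

lemma divisor_two_primepowE:
  fixes p d :: nat
  assumes "prime p" "d dvd 2 ^ k * p ^ m"
  obtains i j where "d = 2 ^ i * p ^ j" "i \<le> k" "j \<le> m"
proof -
  obtain x y where xy: "d = x * y" "x dvd 2 ^ k" "y dvd p ^ m"
    using division_decomp[OF assms(2)] by blast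
  obtain i where "i \<le> k" "x = 2 ^ i"
    using xy(2) by (auto simp: divides_primepow_nat)
  moreover obtain j where "j \<le> m" "y = p ^ j"
    using xy(3) assms(1) by (auto simp: divides_primepow_nat)
  ultimately show ?thesis
    using that xy(1) by blast
qed

text \<open>The divisors correspond bijectively to pairs of exponents, since the multiplicity of 2
  recovers \<open>i\<close> for odd \<open>p\<close>; the sum over pairs then factors.\<close>

lemma divisor_sum_two_primepow:
  fixes p :: nat
  assumes "prime p" "odd p"
  shows "divisor_sum (2 ^ k * p ^ m) = (2 ^ (k + 1) - 1) * (\<Sum>i\<le>m. p ^ i)"
proof -
  have divs: "{d. d dvd 2 ^ k * p ^ m} = (\<lambda>(i, j). 2 ^ i * p ^ j) ` ({..k} \<times> {..m})"
  proof (intro equalityI subsetI)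
    fix d assume "d \<in> {d. d dvd 2 ^ k * p ^ m}"
    then obtain i j where "d = 2 ^ i * p ^ j" "i \<le> k" "j \<le> m"
      using divisor_two_primepowE[OF assms(1)] by blast
    then show "d \<in> (\<lambda>(i, j). 2 ^ i * p ^ j) ` ({..k} \<times> {..m})"
      by auto
  qed (auto intro!: mult_dvd_mono le_imp_power_dvd)
  have inj: "inj_on (\<lambda>(i, j). 2 ^ i * p ^ j) ({..k} \<times> {..m})"
  proof (rule inj_onI, clarify)
    fix i j i' j' :: nat
    assume eq: "2 ^ i * p ^ j = 2 ^ i' * p ^ j'"
    have "multiplicity 2 (2 ^ r * p ^ s) = r" for r s
      using assms by (intro multiplicity_eqI) (auto simp: prime_dvd_mult_iff)
    then have "i = i'"
      by (metis eq)
    moreover from this eq have "p ^ j = p ^ j'"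
      by simp
    then have "j = j'"
      using prime_gt_1_nat[OF assms(1)] by simp
    ultimately show "i = i' \<and> j = j'" ..
  qed
  have geo: "(\<Sum>i\<le>k. 2 ^ i) = (2::nat) ^ (k + 1) - 1"
    by (induction k) auto
  have "divisor_sum (2 ^ k * p ^ m) = (\<Sum>(i, j)\<in>{..k} \<times> {..m}. 2 ^ i * p ^ j)"
    unfolding divisor_sum_def divs by (subst sum.reindex[OF inj]) (simp add: case_prod_unfold)
  also have "\<dots> = (\<Sum>i\<le>k. 2 ^ i) * (\<Sum>j\<le>m. p ^ j)"
    by (simp add: sum_product sum.cartesian_product)
  finally show ?thesis
    by (simp only: geo)
qed

section \<open>From omitted divisors to exponents\<close>

theorem theorem3:
  fixes k m p n d1 d2 :: nat
  assumes "k \<ge> 1" and "m \<ge> 3"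
    and "prime p" and "odd p"
    and "n = 2 ^ k * p ^ m"
    and "two_near_perfect n"
    and "omitted_divisors n d1 d2"
  shows "m = 3 \<and> p = 2 ^ (k + 1) - 1 \<and> {d1, d2} = {p, p ^ 2}"
proof -
  have "p \<ge> 3"
    using prime_ge_2_nat[OF \<open>prime p\<close>] \<open>odd p\<close> by (cases "p = 2") auto
  have dvd: "d1 dvd 2 ^ k * p ^ m" "d2 dvd 2 ^ k * p ^ m"
    using assms by (auto simp: omitted_divisors_def)
  obtain a b where d1: "d1 = 2 ^ a * p ^ b" "a \<le> k" "b \<le> m"
    using divisor_two_primepowE[OF \<open>prime p\<close> dvd(1)] .
  obtain c e where d2: "d2 = 2 ^ c * p ^ e" "c \<le> k" "e \<le> m"
    using divisor_two_primepowE[OF \<open>prime p\<close> dvd(2)] .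
  have ne: "d1 \<noteq> d2" and sigma: "divisor_sum n = 2 * n + d1 + d2"
    using assms(7) by (auto simp: omitted_divisors_def)
  have "int (divisor_sum n) = (2 ^ (k + 1) - 1) * ((\<Sum>i<m. int p ^ i) + int p ^ m)"
    unfolding assms(5) divisor_sum_two_primepow[OF \<open>prime p\<close> \<open>odd p\<close>]
    by (simp add: of_nat_diff flip: lessThan_Suc_atMost)
  \<comment> \<open>As \<open>2 * n = 2 ^ (k + 1) * p ^ m\<close>, the top term of the geometric sum
    cancels against it up to a single \<open>p ^ m\<close>.\<close>
  then have eq: "(2 ^ (k + 1) - 1) * (\<Sum>i<m. int p ^ i) = int p ^ m + int d1 + int d2"
    unfolding sigma by (simp add: assms(5) algebra_simps)
  \<comment> \<open>Generic exponents let the same fact serve both orders of the divisors.\<close>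
  have concl: "m = 3 \<and> p = 2 ^ (k + 1) - 1 \<and> 2 ^ i * p ^ j = p \<and> 2 ^ i' * p ^ j' = p ^ 2"
    if "omitted_exponents (int p) k m i j i' j'" for i j i' j'
  proof -
    interpret omitted_exponents "int p" k m i j i' j'
      by (rule that)
    have *: "m = 3" "N = int p + 1" "i = 0" "j = 1" "i' = 0" "j' = 2"
      using exponents_unique by auto
    from *(2) have "int (2 ^ (k + 1)) = int (p + 1)"
      by (simp add: N_def)
    then have "2 ^ (k + 1) = p + 1"
      by (simp only: of_nat_eq_iff)
    then show ?thesis
      using * by simp
  qed
  show ?thesis
  proof (cases "b \<le> e")
    case True
    have "omitted_exponents (int p) k m a b c e"
      using \<open>p \<ge> 3\<close> assms d1 d2 ne eq True by unfold_locales auto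
    then have "m = 3 \<and> p = 2 ^ (k + 1) - 1 \<and> d1 = p \<and> d2 = p ^ 2"
      unfolding d1(1) d2(1) by (rule concl)
    then show ?thesis
      by blast
  next
    case False
    have "omitted_exponents (int p) k m c e a b"
      using \<open>p \<ge> 3\<close> assms d1 d2 ne eq False by unfold_locales auto
    then have "m = 3 \<and> p = 2 ^ (k + 1) - 1 \<and> d2 = p \<and> d1 = p ^ 2"
      unfolding d1(1) d2(1) by (rule concl)
    then show ?thesis
      by blast
  qed
qed

end
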